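(* Let $\mathbf X\in\mathbb R^{n\times d}$ with $n\ge d$, let $\lambda\ge0$ and $s\in\{0,\dots,n\}$, where in the case $\lambda=0$ it is assumed that $\mathbf X$ has rank $d$ and $s\ge d$. Then algorithm RegVol$(\mathbf X,s,\lambda)$ produces an index set $S$ distributed according to $\lambda$-regularized size $s$ volume sampling over $\mathbf X$, in time $O((n-s+d)nd)$.
   Context: $\mathbf x_i^\top$ is the $i$-th row of $\mathbf X$; $\mathbf X_S$ is the submatrix of rows indexed by $S$. Time counts elementary real arithmetic operations and elementary random draws (sampling an index from an explicit list of $m$ nonnegative weights costs $O(m)$). $\lambda$-regularized size $s$ volume sampling over $\mathbf X$ is the distribution of the set obtained as follows: start with $S=\{1,\dots,n\}$; while $|S|>s$, pick $i\in S$ with probability proportional to $\dfrac{\det(\mathbf X_{S\setminus\{i\}}^\top\mathbf X_{S\setminus\{i\}}+\lambda\mathbf I)}{\det(\mathbf X_S^\top\mathbf X_S+\lambda\mathbf I)}$ and replace $S$ by $S\setminus\{i\}$. Algorithm RegVol$(\mathbf X,s,\lambda)$: (1) $\mathbf Z\leftarrow(\mathbf X^\top\mathbf X+\lambda\mathbf I)^{-1}$; (2) for all $i\in\{1,\dots,n\}$, $h_i\leftarrow1-\mathbf x_i^\top\mathbf Z\mathbf x_i$; (3) $S\leftarrow\{1,\dots,n\}$; (4) while $|S|>s$: sample $i\in S$ with probability proportional to $h_i$; $S\leftarrow S\setminus\{i\}$; $\mathbf v\leftarrow\mathbf Z\mathbf x_i/\sqrt{h_i}$; for all $j\in S$, $h_j\leftarrow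 h_j-(\mathbf x_j^\top\mathbf v)^2$; $\mathbf Z\leftarrow\mathbf Z+\mathbf v\mathbf v^\top$; (5) return $S$. *)

theory Defs
  imports "HOL-Probability.SPMF" "HOL-Library.Landau_Symbols"
    "Jordan_Normal_Form.DL_Rank" "Jordan_Normal_Form.DL_Submatrix"
    "Jordan_Normal_Form.Determinant"
begin

unbundle no vec_syntax
hide_const (open) Determinants.det Finite_Cartesian_Product.mat Finite_Cartesian_Product.transpose
  Finite_Cartesian_Product.row Finite_Cartesian_Product.vec Finite_Cartesian_Product.matrix

section \<open>Regularized volume sampling\<close>

text \<open>Rows are indexed by \<open>{0..<n}\<close>. Random experiments live in the \<open>spmf\<close> monad, where the
  missing mass is the probability of running into something undefined (or of not terminating).\<close>

text \<open>Pick \<open>i \<in> S\<close> with probability proportional to \<open>w i\<close>; undefined unless the weights are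
  nonnegative and not all zero.\<close>

definition draw :: "nat set \<Rightarrow> (nat \<Rightarrow> real) \<Rightarrow> nat spmf" where
  "draw S w =
     (if (\<forall>i\<in>S. 0 \<le> w i) \<and> 0 < sum w S
      then spmf_of_pmf (embed_pmf (\<lambda>i. if i \<in> S then w i / sum w S else 0))
      else return_pmf None)"

definition reg_gram :: "real mat \<Rightarrow> real \<Rightarrow> nat set \<Rightarrow> real mat" where
  "reg_gram X lam S =
     (let XS = submatrix X S UNIV in transpose_mat XS * XS + lam \<cdot>\<^sub>m 1\<^sub>m (dim_col X))"

partial_function (spmf) vol_sampling_loop ::
  "real mat \<Rightarrow> nat \<Rightarrow> real \<Rightarrow> nat set \<Rightarrow> nat set spmf" where
  "vol_sampling_loop X s lam S =
     (if card S > s then do {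
        i \<leftarrow> draw S (\<lambda>i. det (reg_gram X lam (S - {i})) / det (reg_gram X lam S));
        vol_sampling_loop X s lam (S - {i})
      } else return_spmf S)"

definition vol_sampling :: "real mat \<Rightarrow> nat \<Rightarrow> real \<Rightarrow> nat set spmf" where
  "vol_sampling X s lam = vol_sampling_loop X s lam {0..<dim_row X}"

section \<open>Randomized real-number programs with a step count\<close>

text \<open>A program yields a result together with the time consumed. All arithmetic on reals has to
  go through the unit-cost operations below; reading and storing entries, index bookkeeping and
  the maintenance of the set \<open>S\<close> are free. Division by zero, roots of negative numbers and
  ill-formed draws abort.\<close>

type_synonym 'a prog = "('a \<times> nat) spmf"

definition ret :: "'a \<Rightarrow> 'a prog" where
  "ret x = return_spmf (x, 0)"

definition bind_prog :: "'a prog \<Rightarrow> ('a \<Rightarrow> 'b prog) \<Rightarrow> 'b prog" where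
  "bind_prog m f = bind_spmf m (\<lambda>(x, t). map_spmf (\<lambda>(y, u). (y, t + u)) (f x))"

lemma bind_prog_mono [partial_function_mono]:
  assumes "mono_spmf B" "\<And>y. mono_spmf (\<lambda>f. C y f)"
  shows "mono_spmf (\<lambda>f. bind_prog (B f) (\<lambda>y. C y f))"
  unfolding bind_prog_def case_prod_beta
  by (intro bind_spmf_mono map_spmf_mono assms)

definition unit_cost :: "real \<Rightarrow> real prog" where
  "unit_cost x = return_spmf (x, 1)"

definition add_op :: "real \<Rightarrow> real \<Rightarrow> real prog" where
  "add_op x y = unit_cost (x + y)"

definition sub_op :: "real \<Rightarrow> real \<Rightarrow> real prog" where
  "sub_op x y = unit_cost (x - y)"

definition mul_op :: "real \<Rightarrow> real \<Rightarrow> real prog" where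
  "mul_op x y = unit_cost (x * y)"

definition div_op :: "real \<Rightarrow> real \<Rightarrow> real prog" where
  "div_op x y = (if y = 0 then return_pmf None else unit_cost (x / y))"

definition sqrt_op :: "real \<Rightarrow> real prog" where
  "sqrt_op x = (if x < 0 then return_pmf None else unit_cost (sqrt x))"

text \<open>\<open>draw_cost m\<close> is the time charged for sampling from an explicit list of \<open>m\<close> weights.\<close>

definition draw_op :: "(nat \<Rightarrow> nat) \<Rightarrow> nat set \<Rightarrow> (nat \<Rightarrow> real) \<Rightarrow> nat prog" where
  "draw_op draw_cost S w = map_spmf (\<lambda>i. (i, draw_cost (card S))) (draw S w)"

no_adhoc_overloading Monad_Syntax.bind \<rightleftharpoons> bind_spmf
adhoc_overloading Monad_Syntax.bind \<rightleftharpoons> bind_prog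

primrec fold_prog :: "('a \<Rightarrow> 'b \<Rightarrow> 'b prog) \<Rightarrow> 'a list \<Rightarrow> 'b \<Rightarrow> 'b prog" where
  "fold_prog f [] b = ret b"
| "fold_prog f (a # as) b = do { b' \<leftarrow> f a b; fold_prog f as b' }"

primrec map_prog :: "('a \<Rightarrow> 'b prog) \<Rightarrow> 'a list \<Rightarrow> 'b list prog" where
  "map_prog f [] = ret []"
| "map_prog f (a # as) = do { b \<leftarrow> f a; bs \<leftarrow> map_prog f as; ret (b # bs) }"

definition vec_prog :: "nat \<Rightarrow> (nat \<Rightarrow> real prog) \<Rightarrow> real vec prog" where
  "vec_prog n f = do { xs \<leftarrow> map_prog f [0..<n]; ret (vec_of_list xs) }"

definition mat_prog :: "nat \<Rightarrow> nat \<Rightarrow> (nat \<Rightarrow> nat \<Rightarrow> real prog) \<Rightarrow> real mat prog" where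
  "mat_prog nr nc f = do {
     rows \<leftarrow> map_prog (\<lambda>i. map_prog (f i) [0..<nc]) [0..<nr];
     ret (mat_of_rows_list nc rows)
   }"

definition dot_prog :: "real vec \<Rightarrow> real vec \<Rightarrow> real prog" where
  "dot_prog u v =
     fold_prog (\<lambda>k acc. do { p \<leftarrow> mul_op (u $ k) (v $ k); add_op acc p }) [0..<dim_vec v] 0"

definition mat_vec_prog :: "real mat \<Rightarrow> real vec \<Rightarrow> real vec prog" where
  "mat_vec_prog A v = vec_prog (dim_row A) (\<lambda>i. dot_prog (row A i) v)"

definition reg_gram_prog :: "real mat \<Rightarrow> real \<Rightarrow> real mat prog" where
  "reg_gram_prog X lam = mat_prog (dim_col X) (dim_col X) (\<lambda>i j. do {
     g \<leftarrow> dot_prog (col X i) (col X j);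
     if i = j then add_op g lam else ret g
   })"

text \<open>In-place Gauss-Jordan inversion. Step \<open>k\<close> solves the \<open>k\<close>-th equation of \<open>y = A x\<close> for
  \<open>x\<^sub>k\<close>, thereby exchanging the roles of \<open>x\<^sub>k\<close> and \<open>y\<^sub>k\<close>; after all steps the matrix expresses
  \<open>x\<close> through \<open>y\<close>. No pivot search is done, as it is only applied to positive definite
  matrices, where the pivots are never zero.\<close>

definition exchange_prog :: "nat \<Rightarrow> real mat \<Rightarrow> real mat prog" where
  "exchange_prog k A = mat_prog (dim_row A) (dim_row A) (\<lambda>i j.
     if i = k \<and> j = k then div_op 1 (A $$ (k, k))
     else if i = k then do { q \<leftarrow> div_op (A $$ (k, j)) (A $$ (k, k)); sub_op 0 q }
     else if j = k then div_op (A $$ (i, k)) (A $$ (k, k))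
     else do {
       q \<leftarrow> div_op (A $$ (k, j)) (A $$ (k, k));
       p \<leftarrow> mul_op (A $$ (i, k)) q;
       sub_op (A $$ (i, j)) p
     })"

definition inverse_prog :: "real mat \<Rightarrow> real mat prog" where
  "inverse_prog A = fold_prog exchange_prog [0..<dim_row A] A"

section \<open>The algorithm\<close>

partial_function (spmf) regvol_loop ::
  "(nat \<Rightarrow> nat) \<Rightarrow> real mat \<Rightarrow> nat \<Rightarrow> real mat \<Rightarrow> real vec \<Rightarrow> nat set \<Rightarrow> nat set prog" where
  "regvol_loop draw_cost X s Z h S =
     (if card S > s then do {
        i \<leftarrow> draw_op draw_cost S (\<lambda>i. h $ i);
        let S' = S - {i};
        u \<leftarrow> mat_vec_prog Z (row X i);
        r \<leftarrow> sqrt_op (h $ i);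
        v \<leftarrow> vec_prog (dim_vec u) (\<lambda>a. div_op (u $ a) r);
        h' \<leftarrow> vec_prog (dim_vec h) (\<lambda>j.
          if j \<in> S' then do {
            q \<leftarrow> dot_prog (row X j) v;
            q2 \<leftarrow> mul_op q q;
            sub_op (h $ j) q2
          } else ret (h $ j));
        Z' \<leftarrow> mat_prog (dim_row Z) (dim_col Z) (\<lambda>a b. do {
          p \<leftarrow> mul_op (v $ a) (v $ b);
          add_op (Z $$ (a, b)) p
        });
        regvol_loop draw_cost X s Z' h' S'
      } else ret S)"

definition regvol :: "(nat \<Rightarrow> nat) \<Rightarrow> real mat \<Rightarrow> nat \<Rightarrow> real \<Rightarrow> nat set prog" where
  "regvol draw_cost X s lam = do {
     G \<leftarrow> reg_gram_prog X lam;
     Z \<leftarrow> inverse_prog G;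
     h \<leftarrow> vec_prog (dim_row X) (\<lambda>i. do {
       u \<leftarrow> mat_vec_prog Z (row X i);
       q \<leftarrow> dot_prog (row X i) u;
       sub_op 1 q
     });
     regvol_loop draw_cost X s Z h {0..<dim_row X}
   }"

no_adhoc_overloading Monad_Syntax.bind \<rightleftharpoons> bind_prog
adhoc_overloading Monad_Syntax.bind \<rightleftharpoons> bind_spmf

end

theory Submission
  imports Defs
begin

text \<open>
  Write \<open>G\<^sub>S = X\<^sub>S\<^sup>T X\<^sub>S + \<lambda>I\<close>. The loop of the algorithm maintains \<open>Z = G\<^sub>S\<^sup>-\<^sup>1\<close> and
  \<open>h\<^sub>j = 1 - x\<^sub>j\<^sup>T Z x\<^sub>j\<close> for \<open>j \<in> S\<close>. By the matrix determinant lemma, \<open>h\<^sub>i\<close> is exactly the ratio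
  \<open>det G\<^bsub>S - {i}\<^esub> / det G\<^sub>S\<close>, so both processes draw from the same weights, and the
  Sherman--Morrison formula shows that the update preserves the invariant. An index with
  \<open>h\<^sub>i = 0\<close> is never drawn, so \<open>G\<^sub>S\<close> stays nonsingular along every possible run. The draws are well
  defined: for \<open>\<lambda> > 0\<close> all weights are positive, and for \<open>\<lambda> = 0\<close> they sum to \<open>|S| - d > 0\<close>.
\<close>

no_notation Inner_Product.inner (infixl "\<bullet>" 70)

section \<open>Rank-one updates\<close>

definition outer :: "'a :: semiring_0 vec \<Rightarrow> 'a vec \<Rightarrow> 'a mat" where
  "outer u v = mat (dim_vec u) (dim_vec v) (\<lambda>(i, j). u $ i * v $ j)"

lemma outer_carrier [simp]: "u \<in> carrier_vec m \<Longrightarrow> v \<in> carrier_vec n \<Longrightarrow> outer u v \<in> carrier_mat m n"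
  by (auto simp: outer_def)

lemma mat_mult_outer:
  assumes "A \<in> carrier_mat k m" "u \<in> carrier_vec m" "v \<in> carrier_vec n"
  shows "A * outer u v = outer (A *\<^sub>v u) (v :: 'a :: comm_semiring_0 vec)"
  using assms
  by (intro eq_matI) (auto simp: outer_def scalar_prod_def sum_distrib_right mult.assoc)

lemma outer_mult_mat:
  assumes "A \<in> carrier_mat n k" "u \<in> carrier_vec m" "v \<in> carrier_vec n"
  shows "outer u v * A = outer u (A\<^sup>T *\<^sub>v (v :: 'a :: comm_semiring_0 vec))"
  using assms
  by (intro eq_matI) (auto simp: outer_def scalar_prod_def sum_distrib_left mult_ac)

lemma outer_mult_vec:
  assumes "u \<in> carrier_vec m" "v \<in> carrier_vec n" "w \<in> carrier_vec n"
  shows "outer u v *\<^sub>v w = (v \<bullet> w) \<cdot>\<^sub>v (u :: 'a :: comm_semiring_0 vec)"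
  using assms
  by (intro eq_vecI) (auto simp: outer_def scalar_prod_def sum_distrib_left sum_distrib_right mult_ac)

text \<open>The bordered matrix with blocks \<open>1\<close>, \<open>U\<close>, \<open>V\<close>,
  \<open>1\<close> factors both as \<open>?L * ?R\<close> and as \<open>?R' * ?L\<close>. All
  factors are block triangular, so comparing determinants needs no division.\<close>

lemma det_one_minus_outer:
  fixes u v :: "'a :: idom vec"
  assumes u: "u \<in> carrier_vec n" and v: "v \<in> carrier_vec n"
  shows "det (1\<^sub>m n - outer u v) = 1 - v \<bullet> u"
proof -
  define U where "U = mat n 1 (\<lambda>(i, j). u $ i)"
  define V where "V = mat 1 n (\<lambda>(i, j). v $ j)"
  define c where "c = mat 1 1 (\<lambda>_. 1 - v \<bullet> u)"
  have car: "U \<in> carrier_mat n 1" "V \<in> carrier_mat 1 n" "c \<in> carrier_mat 1 1"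
    by (auto simp: U_def V_def c_def)
  note [simp] = car[simplified] car[THEN left_mult_one_mat, simplified] car[THEN right_mult_one_mat, simplified]
    left_mult_zero_mat[OF car(3), simplified] right_add_zero_mat[OF car(1), simplified]
    right_add_zero_mat[OF car(2), simplified]
  have UV: "U * V = outer u v" and VU: "V * U + c = 1\<^sub>m 1"
    using u v by (auto intro!: eq_matI simp: U_def V_def c_def outer_def scalar_prod_def)
  let ?L = "four_block_mat (1\<^sub>m n) (0\<^sub>m n 1) V (1\<^sub>m 1)"
  let ?R = "four_block_mat (1\<^sub>m n) U (0\<^sub>m 1 n) c"
  let ?R' = "four_block_mat (1\<^sub>m n - outer u v) U (0\<^sub>m 1 n) (1\<^sub>m 1)"
  have dims: "?L \<in> carrier_mat (n + 1) (n + 1)" "?R \<in> carrier_mat (n + 1) (n + 1)"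
      "?R' \<in> carrier_mat (n + 1) (n + 1)"
    by (intro four_block_carrier_mat car one_carrier_mat minus_carrier_mat outer_carrier u v)+
  have "?L * ?R = four_block_mat (1\<^sub>m n) U V (1\<^sub>m 1)"
    by (subst mult_four_block_mat[where ?nr1.0 = n and ?n1.0 = n and ?n2.0 = 1 and ?nr2.0 = 1
          and ?nc1.0 = n and ?nc2.0 = 1]) (auto simp: VU[simplified])
  moreover have E: "1\<^sub>m n - outer u v \<in> carrier_mat n n"
    using u v by (intro minus_carrier_mat outer_carrier)
  have "1\<^sub>m n - outer u v + outer u v = 1\<^sub>m n"
    using u v by (intro eq_matI) (auto simp: outer_def)
  hence "?R' * ?L = four_block_mat (1\<^sub>m n) U V (1\<^sub>m 1)"
    using u v
    by (subst mult_four_block_mat[where ?nr1.0 = n and ?n1.0 = n and ?n2.0 = 1 and ?nr2.0 = 1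
          and ?nc1.0 = n and ?nc2.0 = 1]) (auto simp: E UV right_mult_one_mat[OF E] right_mult_zero_mat[OF E]
          left_add_zero_mat[OF car(1), simplified])
  ultimately have "det (?L * ?R) = det (?R' * ?L)"
    by simp
  hence "det ?L * det ?R = det ?R' * det ?L"
    using dims by (simp add: det_mult)
  moreover have "det ?L = 1"
    by (subst det_four_block_mat_upper_right_zero[where n = n and m = 1]) auto
  moreover have "det ?R = 1 - v \<bullet> u"
    by (subst det_four_block_mat_lower_left_zero[where n = n and m = 1])
       (auto simp: det_single c_def)
  moreover have "det ?R' = det (1\<^sub>m n - outer u v)"
    using E by (subst det_four_block_mat_lower_left_zero[where n = n and m = 1]) auto
  ultimately show ?thesis by simp
qed

text \<open>Factor out \<open>A\<close>: as \<open>A *\<^sub>v (Z *\<^sub>v u) = u\<close>, the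
  updated matrix is \<open>A * (1\<^sub>m n - outer (Z *\<^sub>v u) v)\<close>.\<close>

lemma det_minus_outer:
  fixes A Z :: "'a :: idom mat"
  assumes A: "A \<in> carrier_mat n n" and Z: "Z \<in> carrier_mat n n" and inv: "A * Z = 1\<^sub>m n"
    and u: "u \<in> carrier_vec n" and v: "v \<in> carrier_vec n"
  shows "det (A - outer u v) = det A * (1 - v \<bullet> (Z *\<^sub>v u))"
proof -
  have "A *\<^sub>v (Z *\<^sub>v u) = u"
    using assms by (metis assoc_mult_mat_vec one_mult_mat_vec)
  hence "A * (1\<^sub>m n - outer (Z *\<^sub>v u) v) = A - outer u v"
    using assms by (simp add: mult_minus_distrib_mat[where n = n and nc = n] mat_mult_outer[where n = n and m = n])
  thus ?thesis
    using assms det_mult[of A n "1\<^sub>m n - outer (Z *\<^sub>v u) v"]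
    by (simp add: det_one_minus_outer minus_carrier_mat)
qed

text \<open>Transposing \<open>A * Z = 1\<^sub>m n\<close> makes \<open>Z\<^sup>T\<close> a left
  inverse of \<open>A\<close>, and a left and a right inverse coincide.\<close>

lemma symmetric_inverse:
  fixes A Z :: "'a :: field mat"
  assumes A: "A \<in> carrier_mat n n" and Z: "Z \<in> carrier_mat n n" and inv: "A * Z = 1\<^sub>m n"
    and sym: "A\<^sup>T = A"
  shows "Z\<^sup>T = Z"
proof -
  have "Z\<^sup>T * A = 1\<^sub>m n"
    using A Z inv sym by (metis transpose_mult transpose_one)
  hence "Z\<^sup>T * (A * Z) = 1\<^sub>m n * Z"
    using A Z by (metis assoc_mult_mat transpose_carrier_mat)
  thus ?thesis using A Z inv by simp
qed

text \<open>With \<open>u = Z *\<^sub>v x\<close>, the updated matrix times \<open>Z\<close> falls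
  short of the identity by \<open>outer x u\<close>. As \<open>x \<bullet> u = 1 - h\<close>, the
  updated matrix sends \<open>u\<close> to \<open>h\<close> times \<open>x\<close>, so the
  correction \<open>(1 / h) \<cdot>\<^sub>m outer u u\<close> supplies exactly the missing
  term.\<close>

lemma sherman_morrison:
  fixes A Z :: "real mat"
  assumes A: "A \<in> carrier_mat n n" and Z: "Z \<in> carrier_mat n n" and inv: "A * Z = 1\<^sub>m n"
    and sym: "A\<^sup>T = A" and x: "x \<in> carrier_vec n"
    and h: "h = 1 - x \<bullet> (Z *\<^sub>v x)" "h > 0"
    and v: "v = (1 / sqrt h) \<cdot>\<^sub>v (Z *\<^sub>v x)"
  shows "(A - outer x x) * (Z + outer v v) = 1\<^sub>m n"
proof -
  define u where "u = Z *\<^sub>v x"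
  have u: "u \<in> carrier_vec n" using Z x by (simp add: u_def)
  have Au: "A *\<^sub>v u = x"
    using assms unfolding u_def by (metis assoc_mult_mat_vec one_mult_mat_vec)
  have xu: "x \<bullet> u = 1 - h" by (simp add: h u_def)
  have vv: "outer v v = (1 / h) \<cdot>\<^sub>m outer u u"
    using u h(2) unfolding v u_def[symmetric]
    by (intro eq_matI) (auto simp: outer_def)
  \<comment> \<open>Symmetry turns the vector \<open>Z\<^sup>T *\<^sub>v x\<close>, which arises
    from \<open>outer x x * Z\<close>, into \<open>u\<close>.\<close>
  have symZ: "Z\<^sup>T = Z" by (rule symmetric_inverse[OF A Z inv sym])
  have "(A - outer x x) * (Z + outer v v) = (A - outer x x) * Z + (1 / h) \<cdot>\<^sub>m ((A - outer x x) * outer u u)"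
    using A Z u x
    by (simp add: vv mult_add_distrib_mat[where nr = n and n = n and nc = n]
          mult_smult_distrib[where nr = n and n = n and nc = n] minus_carrier_mat)
  also have "(A - outer x x) * Z = 1\<^sub>m n - outer x u"
    using A Z u x symZ
    by (simp add: minus_mult_distrib_mat[where n = n and nc = n] inv
          outer_mult_mat[where n = n and k = n and m = n] u_def)
  also have "(A - outer x x) * outer u u = outer x u - (1 - h) \<cdot>\<^sub>m outer x u"
  proof -
    have "outer x x *\<^sub>v u = (1 - h) \<cdot>\<^sub>v x"
      using x u by (simp add: outer_mult_vec[where m = n and n = n] xu)
    hence "(A - outer x x) *\<^sub>v u = x - (1 - h) \<cdot>\<^sub>v x"
      using A x u by (simp add: minus_mult_distrib_mat_vec[where nr = n and nc = n] Au)
    thus ?thesis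
      using A x u
      by (subst mat_mult_outer[where m = n and n = n and k = n])
         (auto simp: minus_carrier_mat outer_def algebra_simps intro!: eq_matI)
  qed
  also have "1\<^sub>m n - outer x u + (1 / h) \<cdot>\<^sub>m (outer x u - (1 - h) \<cdot>\<^sub>m outer x u) = 1\<^sub>m n"
    using x u h(2) by (intro eq_matI) (auto simp: outer_def field_simps)
  finally show ?thesis .
qed

section \<open>The regularized Gram matrices\<close>

text \<open>Replaces the renumbered rows of the submatrix by a sum over \<open>S\<close> itself, so
  that removing an index becomes subtracting one summand.\<close>

lemma reg_gram_eq:
  assumes X: "X \<in> carrier_mat n d" and S: "S \<subseteq> {0..<n}"
  shows "reg_gram X lam S =
    mat d d (\<lambda>(a, b). (\<Sum>i\<in>S. X $$ (i, a) * X $$ (i, b)) + (if a = b then lam else 0))"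
proof -
  have fin: "finite S" using S finite_subset by blast
  have rows: "{i. i < n \<and> i \<in> S} = S" using S by auto
  \<comment> \<open>\<open>pick S\<close> lists \<open>S\<close> increasingly; the preimage of an
    element is the number of smaller elements of \<open>S\<close>.\<close>
  have "bij_betw (pick S) {..<card S} S"
  proof (rule bij_betw_imageI)
    show "inj_on (pick S) {..<card S}"
      using pick_mono_le[of _ S] by (auto simp: inj_on_def) (metis linorder_neqE_nat order_less_irrefl)
    show "pick S ` {..<card S} = S"
    proof (intro equalityI subsetI)
      fix i assume "i \<in> S"
      moreover have "{a \<in> S. a < i} \<subset> S" using \<open>i \<in> S\<close> by auto
      ultimately show "i \<in> pick S ` {..<card S}"
        using fin by (intro image_eqI[of _ _ "card {a \<in> S. a < i}"])
          (auto simp: pick_card_in_set psubset_card_mono)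
    qed (use pick_in_set_le in auto)
  qed
  note * = sum.reindex_bij_betw[OF this]
  show ?thesis
    using X
    by (intro eq_matI)
       (auto simp: reg_gram_def Let_def submatrix_def rows pick_UNIV scalar_prod_def
          atLeast0LessThan *[symmetric])
qed

lemma reg_gram_carrier [simp]: "X \<in> carrier_mat n d \<Longrightarrow> reg_gram X lam S \<in> carrier_mat d d"
  by (auto simp: reg_gram_def Let_def submatrix_def)

lemma dim_row_reg_gram [simp]: "dim_row (reg_gram X lam S) = dim_col X"
  by (simp add: reg_gram_def Let_def)

lemma reg_gram_symmetric:
  assumes "X \<in> carrier_mat n d" "S \<subseteq> {0..<n}"
  shows "(reg_gram X lam S)\<^sup>T = reg_gram X lam S"
  unfolding reg_gram_eq[OF assms] by (intro eq_matI) (auto simp: mult.commute)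

lemma reg_gram_remove:
  assumes X: "X \<in> carrier_mat n d" and S: "S \<subseteq> {0..<n}" and i: "i \<in> S"
  shows "reg_gram X lam (S - {i}) = reg_gram X lam S - outer (row X i) (row X i)"
proof -
  have "finite S" "S - {i} \<subseteq> {0..<n}" "i < n" using S i finite_subset by auto
  thus ?thesis
    using X i unfolding reg_gram_eq[OF X S] reg_gram_eq[OF X \<open>S - {i} \<subseteq> {0..<n}\<close>]
    by (intro eq_matI) (auto simp: outer_def sum_diff1)
qed

section \<open>The quadratic form of the Gram matrix and nonsingularity\<close>

lemma reg_gram_mult_vec:
  assumes X: "X \<in> carrier_mat n d" and S: "S \<subseteq> {0..<n}" and v: "v \<in> carrier_vec d" and a: "a < d"
  shows "(reg_gram X lam S *\<^sub>v v) $ a = (\<Sum>i\<in>S. X $$ (i, a) * (row X i \<bullet> v)) + lam * v $ a"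
proof -
  have "(reg_gram X lam S *\<^sub>v v) $ a =
      (\<Sum>b<d. ((\<Sum>i\<in>S. X $$ (i, a) * X $$ (i, b)) + (if a = b then lam else 0)) * v $ b)"
    using v a by (simp add: reg_gram_eq[OF X S] scalar_prod_def atLeast0LessThan)
  also have "\<dots> = (\<Sum>b<d. \<Sum>i\<in>S. X $$ (i, a) * (X $$ (i, b) * v $ b)) + lam * v $ a"
    using a by (simp add: distrib_right sum.distrib sum_distrib_right mult.assoc if_distrib[of "\<lambda>x. x * _"] cong: if_cong)
  also have "(\<Sum>b<d. \<Sum>i\<in>S. X $$ (i, a) * (X $$ (i, b) * v $ b)) = (\<Sum>i\<in>S. X $$ (i, a) * (row X i \<bullet> v))"
    using X S v by (subst sum.swap) (auto intro!: sum.cong simp: scalar_prod_def sum_distrib_left atLeast0LessThan)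
  finally show ?thesis .
qed

text \<open>Source of the definiteness arguments below: for nonnegative \<open>lam\<close> the
  right-hand side is a sum of nonnegative terms.\<close>

lemma reg_gram_quadratic_form:
  assumes X: "X \<in> carrier_mat n d" and S: "S \<subseteq> {0..<n}" and v: "v \<in> carrier_vec d"
  shows "v \<bullet> (reg_gram X lam S *\<^sub>v v) = (\<Sum>i\<in>S. (row X i \<bullet> v)\<^sup>2) + lam * (v \<bullet> v)"
proof -
  have "v \<bullet> (reg_gram X lam S *\<^sub>v v) = (\<Sum>a<d. v $ a * (reg_gram X lam S *\<^sub>v v) $ a)"
    using X unfolding scalar_prod_def by (simp add: atLeast0LessThan del: index_mult_mat_vec(1))
  also have "\<dots> =
      (\<Sum>a<d. v $ a * ((\<Sum>i\<in>S. X $$ (i, a) * (row X i \<bullet> v)) + lam * v $ a))"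
    by (intro sum.cong refl arg_cong2[where f = "(*)"] reg_gram_mult_vec[OF X S v]) simp
  also have "\<dots> = (\<Sum>a<d. \<Sum>i\<in>S. (X $$ (i, a) * v $ a) * (row X i \<bullet> v)) + lam * (v \<bullet> v)"
    using v by (simp add: distrib_left sum.distrib sum_distrib_left scalar_prod_def[of v v] atLeast0LessThan mult_ac)
  also have "(\<Sum>a<d. \<Sum>i\<in>S. (X $$ (i, a) * v $ a) * (row X i \<bullet> v)) = (\<Sum>i\<in>S. (row X i \<bullet> v)\<^sup>2)"
    using X S v
    by (subst sum.swap)
       (auto intro!: sum.cong simp: scalar_prod_def power2_eq_square atLeast0LessThan simp flip: sum_distrib_right)
  finally show ?thesis .
qed

lemma scalar_prod_self_eq_0:
  fixes v :: "real vec"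
  assumes "v \<in> carrier_vec d" "v \<bullet> v = 0"
  shows "v = 0\<^sub>v d"
  using assms by (intro eq_vecI) (auto simp: scalar_prod_def sum_nonneg_eq_0_iff)

lemma scalar_prod_self_nonneg: "0 \<le> (v :: real vec) \<bullet> v"
  by (auto simp: scalar_prod_def intro!: sum_nonneg)

lemma det_nonzeroI:
  fixes A :: "'a :: idom mat"
  assumes "A \<in> carrier_mat d d" "\<And>v. v \<in> carrier_vec d \<Longrightarrow> A *\<^sub>v v = 0\<^sub>v d \<Longrightarrow> v = 0\<^sub>v d"
  shows "det A \<noteq> 0"
  using assms det_0_iff_vec_prod_zero[OF assms(1)] by blast

text \<open>If the form vanished at a nonzero \<open>v\<close>, both of its nonnegative parts would
  vanish. This forces \<open>lam = 0\<close> and orthogonality to all rows in \<open>S\<close>, so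
  \<open>v\<close> would lie in the kernel of a nonsingular matrix.\<close>

lemma reg_gram_positive_definite:
  assumes X: "X \<in> carrier_mat n d" and S: "S \<subseteq> {0..<n}" and lam: "0 \<le> lam"
    and nonsing: "det (reg_gram X lam S) \<noteq> 0"
    and v: "v \<in> carrier_vec d" "v \<noteq> 0\<^sub>v d"
  shows "0 < v \<bullet> (reg_gram X lam S *\<^sub>v v)"
proof -
  have fin: "finite S" using S finite_subset by blast
  let ?q = "v \<bullet> (reg_gram X lam S *\<^sub>v v)"
  have parts: "(\<Sum>i\<in>S. (row X i \<bullet> v)\<^sup>2) \<ge> 0" "lam * (v \<bullet> v) \<ge> 0"
    using lam by (simp_all add: sum_nonneg scalar_prod_self_nonneg)
  moreover have "?q \<noteq> 0"
  proof
    assume "?q = 0"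
    hence zero: "(\<Sum>i\<in>S. (row X i \<bullet> v)\<^sup>2) = 0" "lam * (v \<bullet> v) = 0"
      using parts unfolding reg_gram_quadratic_form[OF X S v(1)] by linarith+
    hence "row X i \<bullet> v = 0" if "i \<in> S" for i
      using that fin by (simp add: sum_nonneg_eq_0_iff)
    moreover have "lam = 0"
      using zero(2) scalar_prod_self_eq_0 v by auto
    ultimately have "(reg_gram X lam S *\<^sub>v v) $ a = 0" if "a < d" for a
      using reg_gram_mult_vec[OF X S v(1) that, of lam] by simp
    hence "reg_gram X lam S *\<^sub>v v = 0\<^sub>v d"
      using X by (intro eq_vecI) (auto simp del: index_mult_mat_vec(1))
    thus False
      using nonsing v det_0_iff_vec_prod_zero[of "reg_gram X lam S" d] X by auto
  qed
  ultimately show ?thesis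
    unfolding reg_gram_quadratic_form[OF X S v(1)] by linarith
qed

lemma det_reg_gram_nonzero:
  assumes X: "X \<in> carrier_mat n d" and S: "S \<subseteq> {0..<n}" and lam: "0 < lam"
  shows "det (reg_gram X lam S) \<noteq> 0"
proof (rule det_nonzeroI)
  show "reg_gram X lam S \<in> carrier_mat d d" using X by simp
  fix v assume v: "v \<in> carrier_vec d" and "reg_gram X lam S *\<^sub>v v = 0\<^sub>v d"
  hence "(\<Sum>i\<in>S. (row X i \<bullet> v)\<^sup>2) + lam * (v \<bullet> v) = 0"
    by (simp flip: reg_gram_quadratic_form[OF X S v])
  moreover have "(\<Sum>i\<in>S. (row X i \<bullet> v)\<^sup>2) \<ge> 0" "lam * (v \<bullet> v) \<ge> 0"
    using lam by (simp_all add: sum_nonneg scalar_prod_self_nonneg)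
  ultimately have "lam * (v \<bullet> v) = 0" by linarith
  thus "v = 0\<^sub>v d" using lam v scalar_prod_self_eq_0 by auto
qed

lemma (in vec_space) full_rank_kernel_trivial:
  assumes A: "A \<in> carrier_mat n nc" and rank: "rank A = nc"
    and v: "v \<in> carrier_vec nc" "A *\<^sub>v v = 0\<^sub>v n"
  shows "v = 0\<^sub>v nc"
proof -
  obtain S where S: "maximal S (\<lambda>T. T \<subseteq> set (cols A) \<and> lin_indpt T)"
    using maximal_exists[of "(\<lambda>T. T \<subseteq> set (cols A) \<and> lin_indpt T)" "card (set (cols A))" "{}"]
    by (meson List.finite_set card_mono empty_iff empty_subsetI finite_lin_indpt2 rev_finite_subset)
  \<comment> \<open>Rank is the size of a maximal independent subset of the set of columns, so full
    rank excludes repeated columns. Only then does a nonzero kernel vector give a linear dependence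
    of that set.\<close>
  have "nc \<le> card (set (cols A))"
    using rank_card_indpt[OF A S] rank S by (simp add: card_mono maximal_def)
  hence "distinct (cols A)"
    using A by (metis card_distinct card_length carrier_matD(2) cols_length le_antisym)
  thus ?thesis
    using lin_depI[OF A v(1) _ v(2)] full_rank_lin_indpt[OF A rank] by blast
qed

text \<open>For \<open>lam = 0\<close> the quadratic form is the squared length of
  \<open>X *\<^sub>v v\<close>, so a kernel vector of the Gram matrix is one of
  \<open>X\<close>.\<close>

lemma det_gram_nonzero:
  fixes X :: "real mat"
  assumes X: "X \<in> carrier_mat n d" and rank: "vec_space.rank n X = d"
  shows "det (reg_gram X 0 {0..<n}) \<noteq> 0"
proof (rule det_nonzeroI)
  show "reg_gram X 0 {0..<n} \<in> carrier_mat d d" using X by simp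
  fix v assume v: "v \<in> carrier_vec d" and "reg_gram X 0 {0..<n} *\<^sub>v v = 0\<^sub>v d"
  hence "(\<Sum>i\<in>{0..<n}. (row X i \<bullet> v)\<^sup>2) = 0"
    using reg_gram_quadratic_form[OF X subset_refl v, of 0] by simp
  hence "X *\<^sub>v v = 0\<^sub>v n"
    using X by (intro eq_vecI) (auto simp: sum_nonneg_eq_0_iff)
  thus "v = 0\<^sub>v d"
    using vec_space.full_rank_kernel_trivial[OF X rank v] by simp
qed

lemma row_carrier_vec: "X \<in> carrier_mat n d \<Longrightarrow> row X i \<in> carrier_vec d"
  by auto

section \<open>Leverage scores and the weights of the draws\<close>

context
  fixes X :: "real mat" and n d :: nat and lam :: real and S :: "nat set" and Z :: "real mat"
  assumes X: "X \<in> carrier_mat n d" and S: "S \<subseteq> {0..<n}" and lam: "0 \<le> lam"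
    and Z: "Z \<in> carrier_mat d d" and inv: "reg_gram X lam S * Z = 1\<^sub>m d"
begin

text \<open>Identifies the algorithm's weight \<open>h $ i\<close> with the determinant ratio that
  defines volume sampling.\<close>

lemma det_reg_gram_remove:
  assumes "i \<in> S"
  shows "det (reg_gram X lam (S - {i})) = det (reg_gram X lam S) * (1 - row X i \<bullet> (Z *\<^sub>v row X i))"
  unfolding reg_gram_remove[OF X S assms]
  by (intro det_minus_outer[OF _ Z inv]) (use X in auto)

lemma det_reg_gram_nonzero_of_inverse: "det (reg_gram X lam S) \<noteq> 0"
  using det_mult[of "reg_gram X lam S" d Z] inv X Z by auto

text \<open>With \<open>w = Z x\<^sub>i\<close> the leverage \<open>l\<close> equals the value at \<open>w\<close> of the quadratic form, which is at
  least \<open>(x\<^sub>i \<bullet> w)\<^sup>2 = l\<^sup>2\<close>.\<close>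

lemma leverage_le_1:
  assumes "i \<in> S"
  shows "row X i \<bullet> (Z *\<^sub>v row X i) \<le> 1"
proof -
  define w where "w = Z *\<^sub>v row X i"
  have w: "w \<in> carrier_vec d" using Z row_carrier_vec[OF X] by (simp add: w_def)
  have fin: "finite S" using S finite_subset by blast
  have "reg_gram X lam S *\<^sub>v w = row X i"
    using inv Z row_carrier_vec[OF X] reg_gram_carrier[OF X]
    unfolding w_def by (metis assoc_mult_mat_vec one_mult_mat_vec)
  hence "row X i \<bullet> w = (\<Sum>j\<in>S. (row X j \<bullet> w)\<^sup>2) + lam * (w \<bullet> w)"
    using reg_gram_quadratic_form[OF X S w, of lam] comm_scalar_prod[OF w row_carrier_vec[OF X]] by simp
  also have "\<dots> \<ge> (row X i \<bullet> w)\<^sup>2"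
    using member_le_sum[of i S "\<lambda>j. (row X j \<bullet> w)\<^sup>2"] assms fin lam
    by (simp add: add_increasing2 scalar_prod_self_nonneg)
  finally have "(row X i \<bullet> w)\<^sup>2 \<le> row X i \<bullet> w" .
  thus ?thesis
    using mult_strict_left_mono[of 1 "row X i \<bullet> w" "row X i \<bullet> w"]
    unfolding w_def[symmetric] power2_eq_square by (cases "row X i \<bullet> w \<le> 1") auto
qed

text \<open>Trace argument: the sum is the trace of \<open>reg_gram X lam S * Z\<close>, which is
  the identity of size \<open>d\<close>; \<open>lam = 0\<close> keeps the diagonal free of an extra
  term.\<close>

lemma sum_leverage:
  assumes "lam = 0"
  shows "(\<Sum>i\<in>S. row X i \<bullet> (Z *\<^sub>v row X i)) = real d"
proof -
  have "row X i \<bullet> (Z *\<^sub>v row X i) = (\<Sum>a<d. \<Sum>b<d. X $$ (i, b) * X $$ (i, a) * Z $$ (a, b))"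
    if "i \<in> S" for i
    using that X S Z
    by (auto simp: scalar_prod_def sum_distrib_left atLeast0LessThan mult_ac intro!: sum.cong)
  hence "(\<Sum>i\<in>S. row X i \<bullet> (Z *\<^sub>v row X i)) =
      (\<Sum>i\<in>S. \<Sum>a<d. \<Sum>b<d. X $$ (i, b) * X $$ (i, a) * Z $$ (a, b))"
    by (intro sum.cong) auto
  also have "\<dots> = (\<Sum>a<d. \<Sum>i\<in>S. \<Sum>b<d. X $$ (i, b) * X $$ (i, a) * Z $$ (a, b))"
    by (rule sum.swap)
  also have "\<dots> = (\<Sum>a<d. \<Sum>b<d. \<Sum>i\<in>S. X $$ (i, b) * X $$ (i, a) * Z $$ (a, b))"
    by (intro sum.cong sum.swap refl)
  also have "\<dots> = (\<Sum>b<d. \<Sum>a<d. \<Sum>i\<in>S. X $$ (i, b) * X $$ (i, a) * Z $$ (a, b))"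
    by (rule sum.swap)
  \<comment> \<open>With \<open>b\<close> outermost, the sum over \<open>S\<close> gives the Gram
    entry \<open>(b, a)\<close> and the sum over \<open>a\<close> the diagonal entry of the
    product.\<close>
  also have "\<dots> = (\<Sum>b<d. (reg_gram X lam S * Z) $$ (b, b))"
    using assms X Z
    by (intro sum.cong refl)
       (auto simp: reg_gram_eq[OF X S] scalar_prod_def sum_distrib_right atLeast0LessThan)
  also have "\<dots> = real d"
    by (simp add: inv)
  finally show ?thesis .
qed

text \<open>For \<open>lam = 0\<close> the sum is \<open>card S - d\<close>. For positive
  \<open>lam\<close> every term is nonnegative, and it is nonzero because removing the row leaves a
  nonzero determinant.\<close>

lemma sum_one_minus_leverage_pos:
  assumes "S \<noteq> {}" "lam = 0 \<Longrightarrow> d < card S"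
  shows "0 < (\<Sum>i\<in>S. 1 - row X i \<bullet> (Z *\<^sub>v row X i))"
proof (cases "lam = 0")
  case True
  thus ?thesis using assms sum_leverage by (simp add: sum_subtractf)
next
  case False
  have "0 < 1 - row X i \<bullet> (Z *\<^sub>v row X i)" if "i \<in> S" for i
  proof -
    have "det (reg_gram X lam (S - {i})) \<noteq> 0"
      using False lam S by (intro det_reg_gram_nonzero[OF X]) auto
    thus ?thesis using det_reg_gram_remove[OF that] leverage_le_1[OF that] by auto
  qed
  thus ?thesis using assms(1) S finite_subset by (intro sum_pos) auto
qed

end

section \<open>Deterministic programs with a time bound\<close>

text \<open>The remainder \<open>q\<close> is an arbitrary program rather than a value, so that a
  deterministic prefix can be stripped off a randomized loop. The prefix cost \<open>t\<close> is
  one number for all runs.\<close>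

definition leads_to :: "'a prog \<Rightarrow> 'a prog \<Rightarrow> nat \<Rightarrow> bool" where
  "leads_to m q T \<longleftrightarrow> (\<exists>t\<le>T. m = map_spmf (apsnd ((+) t)) q)"

abbreviation runs :: "'a prog \<Rightarrow> 'a \<Rightarrow> nat \<Rightarrow> bool" where
  "runs m x T \<equiv> leads_to m (ret x) T"

lemma bind_prog_ret: "bind_prog (ret x) f = f x"
  by (simp add: bind_prog_def ret_def case_prod_unfold)

lemma ret_bind_prog: "bind_prog m ret = m"
  by (simp add: bind_prog_def ret_def case_prod_unfold)

lemma bind_prog_assoc: "bind_prog (bind_prog m f) g = bind_prog m (\<lambda>x. bind_prog (f x) g)"
  by (simp add: bind_prog_def case_prod_unfold bind_map_spmf map_spmf_bind_spmf spmf.map_comp o_def add.assoc)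

lemma leads_to_refl: "leads_to m m T"
  unfolding leads_to_def by (intro exI[of _ 0]) (simp add: apsnd_def map_prod_def case_prod_unfold)

lemma leads_to_bind:
  assumes "runs m x T" "leads_to (f x) q U" "T + U \<le> V"
  shows "leads_to (bind_prog m f) q V"
proof -
  obtain t u where "t \<le> T" "m = return_spmf (x, t)" "u \<le> U" "f x = map_spmf (apsnd ((+) u)) q"
    using assms(1,2) by (auto simp: leads_to_def ret_def)
  thus ?thesis
    using assms(3) unfolding leads_to_def
    by (intro exI[of _ "t + u"])
       (auto simp: bind_prog_def spmf.map_comp case_prod_unfold add.assoc intro!: map_spmf_cong)
qed

text \<open>A deterministic prefix only shifts the time component.\<close>

lemma leads_toD:
  assumes "leads_to m q T"
  shows "lossless_spmf m = lossless_spmf q" "map_spmf fst m = map_spmf fst q"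
    "\<forall>(x, u) \<in> set_spmf q. u \<le> U \<Longrightarrow> \<forall>(x, u) \<in> set_spmf m. u \<le> T + U"
  using assms by (fastforce simp: leads_to_def spmf.map_comp o_def)+

section \<open>Costs of the arithmetic, vector and matrix primitives\<close>

lemma runs_arith:
  assumes "1 \<le> T"
  shows "runs (add_op x y) (x + y) T" "runs (sub_op x y) (x - y) T" "runs (mul_op x y) (x * y) T"
    "y \<noteq> 0 \<Longrightarrow> runs (div_op x y) (x / y) T" "0 \<le> x \<Longrightarrow> runs (sqrt_op x) (sqrt x) T"
  using assms
  by (auto intro!: exI[of _ 1] simp: leads_to_def ret_def unit_cost_def add_op_def sub_op_def mul_op_def div_op_def sqrt_op_def)

lemma runs_map_prog:
  assumes "\<And>a. a \<in> set as \<Longrightarrow> runs (f a) (g a) T"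
  shows "runs (map_prog f as) (map g as) (length as * T)"
  using assms
  by (induction as) (auto intro!: leads_to_refl leads_to_bind)

lemma runs_vec_prog:
  assumes "\<And>i. i < n \<Longrightarrow> runs (f i) (g i) T"
  shows "runs (vec_prog n f) (vec n g) (n * T)"
proof -
  have "vec_of_list (map g [0..<n]) = vec n g"
    by (intro eq_vecI) (auto simp: vec_of_list_index)
  thus ?thesis
    using runs_map_prog[of "[0..<n]" f g T] assms unfolding vec_prog_def
    by (auto intro!: leads_to_bind leads_to_refl)
qed

lemma runs_mat_prog:
  assumes "\<And>i j. i < nr \<Longrightarrow> j < nc \<Longrightarrow> runs (f i j) (g i j) T"
  shows "runs (mat_prog nr nc f) (mat nr nc (\<lambda>(i, j). g i j)) (nr * nc * T)"
proof -
  have "mat_of_rows_list nc (map (\<lambda>i. map (g i) [0..<nc]) [0..<nr]) = mat nr nc (\<lambda>(i, j). g i j)"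
    by (intro eq_matI) (auto simp: mat_of_rows_list_def)
  moreover have "runs (map_prog (f i) [0..<nc]) (map (g i) [0..<nc]) (nc * T)" if "i < nr" for i
    using runs_map_prog[of "[0..<nc]" "f i" "g i" T] assms that by auto
  hence "runs (map_prog (\<lambda>i. map_prog (f i) [0..<nc]) [0..<nr])
      (map (\<lambda>i. map (g i) [0..<nc]) [0..<nr]) (nr * (nc * T))"
    using runs_map_prog[of "[0..<nr]" "\<lambda>i. map_prog (f i) [0..<nc]" "\<lambda>i. map (g i) [0..<nc]"] by auto
  ultimately show ?thesis
    unfolding mat_prog_def by (auto intro!: leads_to_bind leads_to_refl simp: mult.assoc)
qed

text \<open>The premise must hold for every accumulator. This suits scalar products, but not the
  exchange steps, which need a nonzero pivot in the current matrix.\<close>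

lemma runs_fold_prog:
  assumes "\<And>a b. a \<in> set as \<Longrightarrow> runs (f a b) (g a b) T"
  shows "runs (fold_prog f as b) (fold g as b) (length as * T)"
  using assms
  by (induction as arbitrary: b) (auto intro!: leads_to_refl leads_to_bind)

lemma runs_dot_prog:
  "runs (dot_prog u v) (u \<bullet> v) (2 * dim_vec v)"
proof -
  have "fold (\<lambda>k acc. acc + u $ k * v $ k) [0..<m] 0 = (\<Sum>k\<in>{0..<m}. u $ k * v $ k)" for m
    by (induction m) auto
  moreover have "runs (bind_prog (mul_op (u $ k) (v $ k)) (add_op acc)) (acc + u $ k * v $ k) 2" for k acc
    by (rule leads_to_bind[OF runs_arith(3)[of 1] runs_arith(1)[of 1]]) simp_all
  hence "runs (dot_prog u v) (fold (\<lambda>k acc. acc + u $ k * v $ k) [0..<dim_vec v] 0) (length [0..<dim_vec v] * 2)"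
    unfolding dot_prog_def by (intro runs_fold_prog)
  ultimately show ?thesis
    by (simp add: scalar_prod_def mult.commute)
qed

lemma runs_mat_vec_prog: "runs (mat_vec_prog A v) (A *\<^sub>v v) (dim_row A * (2 * dim_vec v))"
  unfolding mat_vec_prog_def mult_mat_vec_def by (intro runs_vec_prog runs_dot_prog)

lemma runs_reg_gram_prog:
  assumes X: "X \<in> carrier_mat n d"
  shows "runs (reg_gram_prog X lam) (reg_gram X lam {0..<n}) (d * d * (2 * n + 1))"
proof -
  let ?g = "\<lambda>i j. if i = j then col X i \<bullet> col X j + lam else col X i \<bullet> col X j"
  have "reg_gram X lam {0..<n} = mat d d (\<lambda>(i, j). ?g i j)"
    using X by (auto simp: reg_gram_eq[OF X subset_refl] scalar_prod_def intro!: eq_matI)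
  moreover have *: "runs (bind_prog (dot_prog (col X i) (col X j)) (\<lambda>g. if i = j then add_op g lam else ret g))
      (?g i j) (2 * n + 1)" for i j
    by (rule leads_to_bind[OF runs_dot_prog, where U = 1])
       (use X in \<open>auto intro: runs_arith leads_to_refl\<close>)
  ultimately show ?thesis
    unfolding reg_gram_prog_def carrier_matD(2)[OF X] by (simp only:) (intro runs_mat_prog *)
qed

section \<open>Gauss--Jordan inversion\<close>

definition exchange :: "nat \<Rightarrow> 'a :: field mat \<Rightarrow> 'a mat" where
  "exchange k A = mat (dim_row A) (dim_row A) (\<lambda>(i, j).
     if i = k \<and> j = k then 1 / A $$ (k, k)
     else if i = k then 0 - A $$ (k, j) / A $$ (k, k)
     else if j = k then A $$ (i, k) / A $$ (k, k)
     else A $$ (i, j) - A $$ (i, k) * (A $$ (k, j) / A $$ (k, k)))"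

lemma exchange_carrier [simp]: "A \<in> carrier_mat d d \<Longrightarrow> exchange k A \<in> carrier_mat d d"
  by (simp add: exchange_def)

text \<open>The factor 3 comes from a generic entry: one division, one product, one
  difference.\<close>

lemma runs_exchange_prog:
  assumes "A $$ (k, k) \<noteq> 0"
  shows "runs (exchange_prog k A) (exchange k A) (dim_row A * dim_row A * 3)"
  unfolding exchange_prog_def exchange_def
proof (intro runs_mat_prog)
  fix i j
  show "runs (if i = k \<and> j = k then div_op 1 (A $$ (k, k))
     else if i = k then bind_prog (div_op (A $$ (k, j)) (A $$ (k, k))) (sub_op 0)
     else if j = k then div_op (A $$ (i, k)) (A $$ (k, k))
     else bind_prog (div_op (A $$ (k, j)) (A $$ (k, k)))
       (\<lambda>q. bind_prog (mul_op (A $$ (i, k)) q) (sub_op (A $$ (i, j)))))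
     (if i = k \<and> j = k then 1 / A $$ (k, k)
     else if i = k then 0 - A $$ (k, j) / A $$ (k, k)
     else if j = k then A $$ (i, k) / A $$ (k, k)
     else A $$ (i, j) - A $$ (i, k) * (A $$ (k, j) / A $$ (k, k))) 3"
  proof -
    have "runs (bind_prog (mul_op x q) (sub_op y)) (y - x * q) 2" for x y q :: real
      by (rule leads_to_bind[OF runs_arith(3)[of 1] runs_arith(2)[of 1]]) simp_all
    moreover have "runs (bind_prog (div_op x (A $$ (k, k))) f) y 3"
      if "runs (f (x / A $$ (k, k))) y 2" for x f and y :: real
      by (rule leads_to_bind[where f = f, OF runs_arith(4)[OF le_refl assms] that]) simp
    ultimately show ?thesis
      using assms by (simp add: runs_arith del: diff_0 times_divide_eq_right)
  qed
qed

text \<open>\<open>y = A x\<close> is equivalent to \<open>out = M inp\<close>, where the vectors \<open>inp\<close> and \<open>out\<close> are \<open>x\<close> and \<open>y\<close>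
  with the first \<open>k\<close> entries swapped.\<close>

definition exchanged :: "nat \<Rightarrow> 'a :: field mat \<Rightarrow> nat \<Rightarrow> 'a mat \<Rightarrow> bool" where
  "exchanged d A k M \<longleftrightarrow> (\<forall>x y.
     (\<forall>i<d. y i = (\<Sum>j<d. A $$ (i, j) * x j)) \<longleftrightarrow>
     (\<forall>i<d. (if i < k then x i else y i) = (\<Sum>j<d. M $$ (i, j) * (if j < k then y j else x j))))"

text \<open>Row \<open>k\<close> is solved for \<open>a k\<close> and the result substituted into
  the other rows. The partial sums \<open>R i\<close> omit column \<open>k\<close> and are thus
  untouched by the exchange.\<close>

lemma exchange_swaps:
  assumes M: "M \<in> carrier_mat d d" and k: "k < d" and pivot: "M $$ (k, k) \<noteq> 0"
  shows "(\<forall>i<d. b i = (\<Sum>j<d. M $$ (i, j) * a j)) \<longleftrightarrow>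
    (\<forall>i<d. (b(k := a k)) i = (\<Sum>j<d. exchange k M $$ (i, j) * (a(k := b k)) j))"
proof -
  define R where "R i = (\<Sum>j\<in>{..<d} - {k}. M $$ (i, j) * a j)" for i
  have split: "(\<Sum>j<d. f j) = f k + (\<Sum>j\<in>{..<d} - {k}. f j)" for f :: "nat \<Rightarrow> 'a"
    using k by (intro sum.remove) auto
  have old: "(\<Sum>j<d. M $$ (i, j) * a j) = M $$ (i, k) * a k + R i" for i
    unfolding split R_def ..
  have new_k: "(\<Sum>j<d. exchange k M $$ (k, j) * (a(k := b k)) j) = (b k - R k) / M $$ (k, k)"
  proof -
    have "(\<Sum>j\<in>{..<d} - {k}. exchange k M $$ (k, j) * (a(k := b k)) j) = - R k / M $$ (k, k)"
      unfolding R_def sum_divide_distrib sum_negf[symmetric]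
      using M k by (intro sum.cong) (auto simp: exchange_def)
    thus ?thesis using M k by (subst split) (simp add: exchange_def diff_divide_distrib)
  qed
  have new: "(\<Sum>j<d. exchange k M $$ (i, j) * (a(k := b k)) j) =
      M $$ (i, k) * ((b k - R k) / M $$ (k, k)) + R i" if "i < d" "i \<noteq> k" for i
  proof -
    have "(\<Sum>j\<in>{..<d} - {k}. exchange k M $$ (i, j) * (a(k := b k)) j) =
        R i - M $$ (i, k) / M $$ (k, k) * R k"
      unfolding R_def sum_distrib_left sum_subtractf[symmetric]
      using M k that by (intro sum.cong) (auto simp: exchange_def algebra_simps)
    thus ?thesis using M k that by (subst split) (simp add: exchange_def diff_divide_distrib algebra_simps)
  qed
  \<comment> \<open>The nonzero pivot makes solving row \<open>k\<close> reversible; both directions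
    of the equivalence rest on this.\<close>
  have "b k = M $$ (k, k) * a k + R k \<longleftrightarrow> a k = (b k - R k) / M $$ (k, k)"
    using pivot by (auto simp: field_simps)
  note pivot_row = this
  define N where "N i = (\<Sum>j<d. exchange k M $$ (i, j) * (a(k := b k)) j)" for i
  note new = new_k[folded N_def] new[folded N_def]
  show ?thesis
    unfolding old N_def[symmetric]
  proof (intro iffI allI impI)
    fix i assume "\<forall>i<d. b i = M $$ (i, k) * a k + R i" "i < d"
    thus "(b(k := a k)) i = N i"
      using pivot_row k new by (cases "i = k") auto
  next
    fix i assume *: "\<forall>i<d. (b(k := a k)) i = N i" and i: "i < d"
    hence "a k = N k" using k by auto
    thus "b i = M $$ (i, k) * a k + R i"
      using pivot_row new * i by (cases "i = k") auto
  qed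
qed

text \<open>The mixed vectors after \<open>Suc k\<close> steps are those after \<open>k\<close>
  steps with their entries at \<open>k\<close> exchanged.\<close>

lemma exchanged_step:
  assumes M: "M \<in> carrier_mat d d" and k: "k < d" and pivot: "M $$ (k, k) \<noteq> 0"
    and ex: "exchanged d A k M"
  shows "exchanged d A (Suc k) (exchange k M)"
  unfolding exchanged_def
proof (intro allI)
  fix x y :: "nat \<Rightarrow> 'a"
  let ?a = "\<lambda>j. if j < k then y j else x j" and ?b = "\<lambda>i. if i < k then x i else y i"
  have "?b(k := ?a k) = (\<lambda>i. if i < Suc k then x i else y i)"
    "?a(k := ?b k) = (\<lambda>j. if j < Suc k then y j else x j)"
    by (auto simp: less_Suc_eq)
  thus "(\<forall>i<d. y i = (\<Sum>j<d. A $$ (i, j) * x j)) \<longleftrightarrow>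
     (\<forall>i<d. (if i < Suc k then x i else y i) =
       (\<Sum>j<d. exchange k M $$ (i, j) * (if j < Suc k then y j else x j)))"
    using ex exchange_swaps[OF M k pivot, of ?b ?a] unfolding exchanged_def by simp
qed

text \<open>Feeding the \<open>k\<close>-th unit vector into \<open>M\<close> yields \<open>x\<close> and \<open>y = A x\<close> with disjoint supports up to
  the index \<open>k\<close>, where \<open>x\<close> is \<open>1\<close> and \<open>y\<close> is the pivot.\<close>

lemma pivot_pos:
  fixes A M :: "real mat"
  assumes A: "A \<in> carrier_mat d d" and k: "k < d" and ex: "exchanged d A k M"
    and pos: "\<And>v. v \<in> carrier_vec d \<Longrightarrow> v \<noteq> 0\<^sub>v d \<Longrightarrow> 0 < v \<bullet> (A *\<^sub>v v)"
  shows "0 < M $$ (k, k)"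
proof -
  define x where "x i = (if i < k then M $$ (i, k) else if i = k then 1 else 0)" for i
  define y where "y i = (if i < k then 0 else M $$ (i, k))" for i
  have "(\<Sum>j<d. M $$ (i, j) * (if j < k then y j else x j)) = M $$ (i, k)" for i
  proof -
    have "(\<Sum>j<d. M $$ (i, j) * (if j < k then y j else x j)) = (\<Sum>j<d. if j = k then M $$ (i, k) else 0)"
      by (intro sum.cong) (auto simp: x_def y_def)
    thus ?thesis using k by simp
  qed
  hence "\<forall>i<d. (if i < k then x i else y i) = (\<Sum>j<d. M $$ (i, j) * (if j < k then y j else x j))"
    by (simp add: x_def y_def)
  hence y: "y i = (\<Sum>j<d. A $$ (i, j) * x j)" if "i < d" for i
    using ex that unfolding exchanged_def by blast
  define v where "v = vec d x"
  have v: "v \<in> carrier_vec d" "v \<noteq> 0\<^sub>v d"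
    using k by (auto simp: v_def x_def dest!: arg_cong[where f = "\<lambda>v. v $ k"])
  have "v \<bullet> (A *\<^sub>v v) = (\<Sum>i<d. x i * y i)"
    using A by (auto simp: v_def scalar_prod_def atLeast0LessThan y intro!: sum.cong)
  also have "\<dots> = (\<Sum>i<d. if i = k then M $$ (k, k) else 0)"
    by (intro sum.cong) (auto simp: x_def y_def)
  also have "\<dots> = M $$ (k, k)"
    using k by simp
  finally show ?thesis
    using pos[OF v] by simp
qed

text \<open>Positive definiteness keeps every pivot nonzero. After \<open>d\<close> steps all inputs
  and outputs are swapped, so the final matrix recovers \<open>x\<close> from
  \<open>y = A x\<close>.\<close>

lemma runs_inverse_prog:
  fixes A :: "real mat"
  assumes A: "A \<in> carrier_mat d d"
    and pos: "\<And>v. v \<in> carrier_vec d \<Longrightarrow> v \<noteq> 0\<^sub>v d \<Longrightarrow> 0 < v \<bullet> (A *\<^sub>v v)"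
  obtains Z where "runs (inverse_prog A) Z (d * (d * d * 3))" "Z \<in> carrier_mat d d" "A * Z = 1\<^sub>m d"
proof -
  \<comment> \<open>The fold unwinds at the front of the list, while the invariant counts completed
    steps; hence the last step has to be split off.\<close>
  have snoc: "fold_prog f (as @ [a]) b = bind_prog (fold_prog f as b) (f a)" for f as and a :: nat and b :: "real mat"
    by (induction as arbitrary: b) (simp_all add: bind_prog_ret bind_prog_assoc, simp add: ret_bind_prog)
  have "\<exists>M. runs (fold_prog exchange_prog [0..<k] A) M (k * (d * d * 3)) \<and> M \<in> carrier_mat d d \<and>
      exchanged d A k M" if "k \<le> d" for k
    using that
  proof (induction k)
    case 0
    thus ?case using A by (auto simp: exchanged_def intro: leads_to_refl)
  next
    case (Suc k)
    then obtain M where M: "runs (fold_prog exchange_prog [0..<k] A) M (k * (d * d * 3))"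
        "M \<in> carrier_mat d d" "exchanged d A k M"
      by auto
    have pivot: "M $$ (k, k) \<noteq> 0"
      using pivot_pos[OF A _ M(3) pos] Suc.prems by simp
    have "runs (fold_prog exchange_prog [0..<Suc k] A) (exchange k M) (Suc k * (d * d * 3))"
      using M(2) runs_exchange_prog[OF pivot]
      by (auto simp: snoc intro!: leads_to_bind[OF M(1)])
    thus ?case
      using exchanged_step[OF M(2) _ pivot M(3)] M(2) Suc.prems by auto
  qed
  from this[of d] obtain M where M: "runs (inverse_prog A) M (d * (d * d * 3))"
      "M \<in> carrier_mat d d" "exchanged d A d M"
    using A by (auto simp: inverse_prog_def)
  have "A * M = 1\<^sub>m d"
  proof (rule eq_matI)
    fix i j assume ij: "i < dim_row (1\<^sub>m d)" "j < dim_col (1\<^sub>m d)"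
    \<comment> \<open>Column \<open>j\<close> of \<open>M\<close> is its output on the
      \<open>j\<close>-th unit vector, so \<open>A\<close> maps it back to that unit vector.\<close>
    let ?x = "\<lambda>l. M $$ (l, j)" and ?y = "\<lambda>l. if l = j then 1 else 0 :: real"
    have "\<forall>l<d. ?x l = (\<Sum>m<d. M $$ (l, m) * ?y m)"
      using ij by (auto simp: if_distrib[of "\<lambda>x. _ * x"] cong: if_cong)
    hence "\<forall>i<d. ?y i = (\<Sum>l<d. A $$ (i, l) * ?x l)"
      using M(3) unfolding exchanged_def by (auto cong: if_cong)
    thus "(A * M) $$ (i, j) = 1\<^sub>m d $$ (i, j)"
      using ij A M(2) by (auto simp: scalar_prod_def atLeast0LessThan)
  qed (use A M(2) in auto)
  with M show ?thesis using that by blast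
qed

section \<open>The sampling loops\<close>

text \<open>The support excludes indices of weight zero; this later licenses dividing by
  \<open>sqrt (h $ i)\<close> for a drawn \<open>i\<close>.\<close>

lemma draw_props:
  assumes S: "finite S" and w: "\<forall>i\<in>S. 0 \<le> w i" "0 < sum w S"
  shows "lossless_spmf (draw S w)" "set_spmf (draw S w) = {i \<in> S. 0 < w i}"
proof -
  let ?f = "\<lambda>i. if i \<in> S then w i / sum w S else 0"
  have nonneg: "0 \<le> ?f i" for i using w by auto
  have "(\<integral>\<^sup>+ i. ennreal (?f i) \<partial>count_space UNIV) = (\<Sum>i\<in>S. ennreal (?f i))"
    using S by (intro nn_integral_count_space') auto
  also have "\<dots> = ennreal (\<Sum>i\<in>S. ?f i)"
    using nonneg by (rule sum_ennreal)
  also have "(\<Sum>i\<in>S. ?f i) = 1"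
    using w by (simp flip: sum_divide_distrib)
  finally have prob: "(\<integral>\<^sup>+ i. ennreal (?f i) \<partial>count_space UNIV) = 1" by simp
  have "draw S w = spmf_of_pmf (embed_pmf ?f)"
    using w by (simp add: draw_def)
  thus "lossless_spmf (draw S w)" "set_spmf (draw S w) = {i \<in> S. 0 < w i}"
    using w by (auto simp: set_embed_pmf[OF nonneg prob] less_le)
qed

lemma draw_cong:
  assumes "\<And>i. i \<in> S \<Longrightarrow> w i = w' i"
  shows "draw S w = draw S w'"
  unfolding draw_def using assms by (simp cong: if_cong sum.cong)

lemma bind_draw_op:
  "bind_prog (draw_op c S w) f = bind_spmf (draw S w) (\<lambda>i. map_spmf (apsnd ((+) (c (card S)))) (f i))"
  by (simp add: bind_prog_def draw_op_def bind_map_spmf o_def case_prod_unfold apsnd_def map_prod_def)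

section \<open>A single iteration of the loop\<close>

definition regvol_direction :: "real mat \<Rightarrow> real mat \<Rightarrow> real vec \<Rightarrow> nat \<Rightarrow> real vec" where
  "regvol_direction X Z h i = (1 / sqrt (h $ i)) \<cdot>\<^sub>v (Z *\<^sub>v row X i)"

text \<open>The continuation \<open>f\<close> stands for the recursive call, which separates the
  deterministic updates from later draws. Here \<open>S\<close> is the set after the removal of
  \<open>i\<close>.\<close>

definition regvol_step ::
  "real mat \<Rightarrow> real mat \<Rightarrow> real vec \<Rightarrow> nat set \<Rightarrow> nat \<Rightarrow> (real mat \<Rightarrow> real vec \<Rightarrow> 'a prog) \<Rightarrow> 'a prog" where
  "regvol_step X Z h S i f =
     bind_prog (mat_vec_prog Z (row X i)) (\<lambda>u.
     bind_prog (sqrt_op (h $ i)) (\<lambda>r.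
     bind_prog (vec_prog (dim_vec u) (\<lambda>a. div_op (u $ a) r)) (\<lambda>v.
     bind_prog (vec_prog (dim_vec h) (\<lambda>j.
        if j \<in> S then bind_prog (dot_prog (row X j) v) (\<lambda>q. bind_prog (mul_op q q) (sub_op (h $ j)))
        else ret (h $ j))) (\<lambda>h'.
     bind_prog (mat_prog (dim_row Z) (dim_col Z) (\<lambda>a b.
        bind_prog (mul_op (v $ a) (v $ b)) (add_op (Z $$ (a, b))))) (\<lambda>Z'.
     f Z' h')))))"

lemma regvol_loop_unfold:
  assumes "s < card S"
  shows "regvol_loop draw_cost X s Z h S = bind_prog (draw_op draw_cost S (\<lambda>i. h $ i))
    (\<lambda>i. regvol_step X Z h (S - {i}) i (\<lambda>Z' h'. regvol_loop draw_cost X s Z' h' (S - {i})))"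
  using assms by (subst regvol_loop.simps) (simp add: regvol_step_def Let_def)

text \<open>The bound lists the costs in order of execution: the product with \<open>Z\<close>, the
  root, the scaling, the update of \<open>h\<close>, the update of \<open>Z\<close>.\<close>

lemma regvol_update:
  assumes X: "X \<in> carrier_mat n d" and Z: "Z \<in> carrier_mat d d" and h: "h \<in> carrier_vec n"
    and pos: "0 < h $ i" and v: "v = regvol_direction X Z h i"
  shows "leads_to (regvol_step X Z h S i f)
    (f (Z + outer v v) (vec n (\<lambda>j. if j \<in> S then h $ j - (row X j \<bullet> v)\<^sup>2 else h $ j)))
    (d * (2 * d) + (1 + (d * 1 + (n * (2 * d + 2) + d * d * 2))))"
proof -
  define u where "u = Z *\<^sub>v row X i"
  have u: "u \<in> carrier_vec d" unfolding u_def by (intro mult_mat_vec_carrier[OF Z] row_carrier_vec[OF X])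
  have "runs (vec_prog (dim_vec u) (\<lambda>a. div_op (u $ a) (sqrt (h $ i))))
      (vec (dim_vec u) (\<lambda>a. u $ a / sqrt (h $ i))) (dim_vec u * 1)"
    using pos by (intro runs_vec_prog runs_arith) auto
  moreover have "vec (dim_vec u) (\<lambda>a. u $ a / sqrt (h $ i)) = v"
    unfolding v regvol_direction_def u_def[symmetric] by (intro eq_vecI) auto
  ultimately have v_run: "runs (vec_prog (dim_vec u) (\<lambda>a. div_op (u $ a) (sqrt (h $ i)))) v (d * 1)"
    using u by auto
  have v_dim: "dim_vec v = d" using Z by (simp add: v regvol_direction_def u_def)
  have "runs (if j \<in> S then bind_prog (dot_prog (row X j) v) (\<lambda>q. bind_prog (mul_op q q) (sub_op (h $ j))) else ret (h $ j))
      (if j \<in> S then h $ j - (row X j \<bullet> v)\<^sup>2 else h $ j) (2 * d + 2)" for j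
  proof (cases "j \<in> S")
    case True
    have square: "runs (bind_prog (mul_op q q) (sub_op (h $ j))) (h $ j - q\<^sup>2) 2" for q
      unfolding power2_eq_square
      by (rule leads_to_bind[OF runs_arith(3)[of 1] runs_arith(2)[of 1]]) simp_all
    have "runs (bind_prog (dot_prog (row X j) v) (\<lambda>q. bind_prog (mul_op q q) (sub_op (h $ j))))
        (h $ j - (row X j \<bullet> v)\<^sup>2) (2 * d + 2)"
      by (rule leads_to_bind[OF runs_dot_prog square]) (simp add: v_dim)
    thus ?thesis using True by simp
  qed (simp add: leads_to_refl)
  hence h_run: "runs (vec_prog (dim_vec h) (\<lambda>j.
        if j \<in> S then bind_prog (dot_prog (row X j) v) (\<lambda>q. bind_prog (mul_op q q) (sub_op (h $ j)))
        else ret (h $ j)))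
      (vec n (\<lambda>j. if j \<in> S then h $ j - (row X j \<bullet> v)\<^sup>2 else h $ j)) (n * (2 * d + 2))"
    unfolding carrier_vecD[OF h] by (intro runs_vec_prog)
  have "runs (bind_prog (mul_op (v $ a) (v $ b)) (add_op (Z $$ (a, b)))) (Z $$ (a, b) + v $ a * v $ b) 2" for a b
    by (rule leads_to_bind[OF runs_arith(3)[of 1] runs_arith(1)[of 1]]) simp_all
  hence "runs (mat_prog d d (\<lambda>a b. bind_prog (mul_op (v $ a) (v $ b)) (add_op (Z $$ (a, b)))))
      (mat d d (\<lambda>(a, b). Z $$ (a, b) + v $ a * v $ b)) (d * d * 2)"
    by (intro runs_mat_prog)
  moreover have "mat d d (\<lambda>(a, b). Z $$ (a, b) + v $ a * v $ b) = Z + outer v v"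
    using Z v_dim by (intro eq_matI) (auto simp: outer_def)
  ultimately have Z_run: "runs (mat_prog (dim_row Z) (dim_col Z) (\<lambda>a b.
        bind_prog (mul_op (v $ a) (v $ b)) (add_op (Z $$ (a, b))))) (Z + outer v v) (d * d * 2)"
    using Z by simp
  have u_run: "runs (mat_vec_prog Z (row X i)) u (d * (2 * d))"
    using runs_mat_vec_prog[of Z "row X i"] Z X by (simp add: u_def)
  have r_run: "runs (sqrt_op (h $ i)) (sqrt (h $ i)) 1"
    using pos by (simp add: runs_arith)
  show ?thesis
    unfolding regvol_step_def
    by (rule leads_to_bind[OF u_run] leads_to_bind[OF r_run] leads_to_bind[OF v_run]
          leads_to_bind[OF h_run] leads_to_bind[OF Z_run leads_to_refl[of _ 0]] order_refl)+ simp
qed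

text \<open>Induction on \<open>card S\<close>, over all \<open>Z\<close> and \<open>h\<close> that
  satisfy the invariant. \<open>T\<close> bounds one iteration without its draw, and
  \<open>K * n\<close> bounds the draw.\<close>

lemma regvol_loop_correct:
  assumes X: "X \<in> carrier_mat n d" and lam: "0 \<le> lam" "lam = 0 \<Longrightarrow> d \<le> s"
    and cost: "\<And>m. 1 \<le> m \<Longrightarrow> draw_cost m \<le> K * m"
    and S: "S \<subseteq> {0..<n}" and Z: "Z \<in> carrier_mat d d" and inv: "reg_gram X lam S * Z = 1\<^sub>m d"
    and h: "h \<in> carrier_vec n" "\<And>j. j \<in> S \<Longrightarrow> h $ j = 1 - row X j \<bullet> (Z *\<^sub>v row X j)"
    and T: "T = d * (2 * d) + (1 + (d * 1 + (n * (2 * d + 2) + d * d * 2)))"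
  shows "lossless_spmf (regvol_loop draw_cost X s Z h S) \<and>
    map_spmf fst (regvol_loop draw_cost X s Z h S) = vol_sampling_loop X s lam S \<and>
    (\<forall>(S', t) \<in> set_spmf (regvol_loop draw_cost X s Z h S). t \<le> (card S - s) * (K * n + T))"
  using S Z inv h
proof (induction "card S" arbitrary: S Z h rule: less_induct)
  case less
  note S = less.prems(1) and Z = less.prems(2) and inv = less.prems(3) and h = less.prems(4,5)
  let ?P = "regvol_loop draw_cost X s"
  have fin: "finite S" using S finite_subset by blast
  show ?case
  proof (cases "card S > s")
    case False
    thus ?thesis
      by (simp add: regvol_loop.simps[of _ _ _ _ _ S] vol_sampling_loop.simps[of _ _ _ S] ret_def)
  next
    case True
    define v where "v i = regvol_direction X Z h i" for i
    define Z' where "Z' i = Z + outer (v i) (v i)" for i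
    define h' where "h' i = vec n (\<lambda>j. if j \<in> S - {i} then h $ j - (row X j \<bullet> v i)\<^sup>2 else h $ j)" for i
    define body where "body i = regvol_step X Z h (S - {i}) i (\<lambda>Z' h'. ?P Z' h' (S - {i}))" for i
    have body: "leads_to (body i) (?P (Z' i) (h' i) (S - {i})) T" if "0 < h $ i" for i
      using regvol_update[OF X Z h(1) that refl] unfolding body_def Z'_def h'_def v_def T .
    have h_eq: "h $ i = det (reg_gram X lam (S - {i})) / det (reg_gram X lam S)" if "i \<in> S" for i
      using that det_reg_gram_remove[OF X S lam(1) Z inv that] det_reg_gram_nonzero_of_inverse[OF X S lam(1) Z inv]
      by (simp add: h(2))
    \<comment> \<open>Together with \<open>h_sum\<close> this makes the draw well defined, so no
      mass is lost here.\<close>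
    have h_nonneg: "\<forall>i\<in>S. 0 \<le> h $ i"
      using leverage_le_1[OF X S lam(1) Z inv] h(2) by fastforce
    have h_sum: "0 < (\<Sum>i\<in>S. h $ i)"
    proof -
      have "S \<noteq> {}" "lam = 0 \<Longrightarrow> d < card S"
        using True lam(2) by auto
      moreover have "(\<Sum>i\<in>S. h $ i) = (\<Sum>i\<in>S. 1 - row X i \<bullet> (Z *\<^sub>v row X i))"
        by (intro sum.cong refl h(2))
      ultimately show ?thesis
        using sum_one_minus_leverage_pos[OF X S lam(1) Z inv] by metis
    qed
    define c where "c = draw_cost (card S)"
    define D where "D = draw S (\<lambda>i. h $ i)"
    note D = draw_props[OF fin h_nonneg h_sum, folded D_def]
    have loop: "?P Z h S = bind_spmf D (\<lambda>i. map_spmf (apsnd ((+) c)) (body i))"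
      unfolding regvol_loop_unfold[OF True] bind_draw_op c_def D_def body_def ..
    have vol: "vol_sampling_loop X s lam S = bind_spmf D (\<lambda>i. vol_sampling_loop X s lam (S - {i}))"
    proof -
      have "draw S (\<lambda>i. det (reg_gram X lam (S - {i})) / det (reg_gram X lam S)) = D"
        unfolding D_def using h_eq by (intro draw_cong) simp
      thus ?thesis
        using True by (simp add: vol_sampling_loop.simps[of X s lam S])
    qed
    have body: "lossless_spmf (body i)" "map_spmf fst (body i) = vol_sampling_loop X s lam (S - {i})"
        "\<forall>(S', t) \<in> set_spmf (body i). t \<le> T + (card (S - {i}) - s) * (K * n + T)"
      if "i \<in> set_spmf D" for i
    proof -
      \<comment> \<open>A drawn index has positive weight, so the root, the divisions and the
        Sherman-Morrison update are legitimate.\<close>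
      have i: "i \<in> S" "0 < h $ i" using that by (auto simp: D)
      have v: "v i \<in> carrier_vec d" unfolding v_def regvol_direction_def
        by (intro smult_carrier_vec[THEN iffD2] mult_mat_vec_carrier[OF Z] row_carrier_vec[OF X])
      have "reg_gram X lam (S - {i}) * Z' i = 1\<^sub>m d"
        unfolding reg_gram_remove[OF X S i(1)] Z'_def v_def regvol_direction_def
        by (rule sherman_morrison[OF _ Z inv reg_gram_symmetric[OF X S] row_carrier_vec[OF X] h(2)[OF i(1)] i(2) refl])
           (use X in auto)
      moreover have "h' i $ j = 1 - row X j \<bullet> (Z' i *\<^sub>v row X j)" if "j \<in> S - {i}" for j
      proof -
        \<comment> \<open>The form of \<open>outer (v i) (v i)\<close> at a row is the squared
          scalar product, which is exactly what the algorithm subtracts from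
          \<open>h\<close>.\<close>
        have "row X j \<bullet> (Z' i *\<^sub>v row X j) = row X j \<bullet> (Z *\<^sub>v row X j) + (row X j \<bullet> v i)\<^sup>2"
          using Z v row_carrier_vec[OF X, of j] comm_scalar_prod[OF v row_carrier_vec[OF X, of j]]
          by (simp add: Z'_def add_mult_distrib_mat_vec[of _ d d] outer_mult_vec[of _ d _ d]
                scalar_prod_add_distrib[of _ d] power2_eq_square)
        thus ?thesis using that S h(2)[of j] by (auto simp: h'_def)
      qed
      moreover have "card (S - {i}) < card S" using fin i(1) by (rule card_Diff1_less)
      ultimately have IH: "lossless_spmf (?P (Z' i) (h' i) (S - {i}))"
          "map_spmf fst (?P (Z' i) (h' i) (S - {i})) = vol_sampling_loop X s lam (S - {i})"
          "\<forall>(S', t) \<in> set_spmf (?P (Z' i) (h' i) (S - {i})). t \<le> (card (S - {i}) - s) * (K * n + T)"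
        using less.hyps[of "S - {i}" "Z' i" "h' i"] S Z v by (auto simp: Z'_def h'_def)
      from leads_toD[OF body[OF i(2)]] IH
      show "lossless_spmf (body i)" "map_spmf fst (body i) = vol_sampling_loop X s lam (S - {i})"
          "\<forall>(S', t) \<in> set_spmf (body i). t \<le> T + (card (S - {i}) - s) * (K * n + T)"
        by auto
    qed
    have "lossless_spmf (?P Z h S)"
      unfolding loop using D(1) body(1) by simp
    moreover have "map_spmf fst (?P Z h S) = vol_sampling_loop X s lam S"
      unfolding loop vol map_spmf_bind_spmf
      by (intro bind_spmf_cong refl) (simp add: spmf.map_comp body(2)[symmetric] cong: map_spmf_cong)
    moreover have "t \<le> (card S - s) * (K * n + T)" if St: "(S', t) \<in> set_spmf (?P Z h S)" for S' t
    proof -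
      obtain i t' where i: "i \<in> set_spmf D" and t': "(S', t') \<in> set_spmf (body i)" "t = c + t'"
        using St unfolding loop by (auto simp: set_bind_spmf)
      have "c \<le> K * n"
      proof -
        have "c \<le> K * card S" unfolding c_def using True by (intro cost) simp
        also have "card S \<le> n" using card_mono[OF _ S] by simp
        finally show ?thesis by simp
      qed
      moreover have "t' \<le> T + (card (S - {i}) - s) * (K * n + T)"
        using body(3)[OF i] t'(1) by blast
      \<comment> \<open>As \<open>card S\<close> exceeds \<open>s\<close>, the truncated difference
        drops by exactly one.\<close>
      moreover have "card S - s = Suc (card (S - {i}) - s)"
        using True i fin D(2) by (simp add: card_Diff_singleton Suc_diff_Suc)
      ultimately show ?thesis by (simp add: t'(2))
    qed
    ultimately show ?thesis by blast
  qed
qed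

section \<open>Constants of the running time and the final bound\<close>

lemma linear_bound_nat:
  fixes f :: "nat \<Rightarrow> nat"
  assumes "(\<lambda>m. real (f m)) \<in> O(\<lambda>m. real m)"
  obtains K where "\<And>m. 1 \<le> m \<Longrightarrow> f m \<le> K * m"
proof -
  from assms obtain c where "eventually (\<lambda>m. norm (real (f m)) \<le> c * norm (real m)) at_top"
    by (elim landau_o.bigE)
  then obtain N where N: "\<And>m. N \<le> m \<Longrightarrow> real (f m) \<le> c * real m"
    by (auto simp: eventually_at_top_linorder)
  \<comment> \<open>From \<open>N\<close> on the asymptotic constant suffices; the finitely many
    earlier values are absorbed by their sum. A bound at \<open>m = 0\<close> would force
    \<open>f 0 = 0\<close>, hence \<open>1 \<le> m\<close>.\<close>
  define K where "K = nat \<lceil>c\<rceil> + (\<Sum>k<N. f k)"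
  have "f m \<le> K * m" if "1 \<le> m" for m
  proof (cases "N \<le> m")
    case True
    have "real (f m) \<le> c * real m" by (rule N[OF True])
    also have "\<dots> \<le> real (nat \<lceil>c\<rceil>) * real m"
      by (intro mult_right_mono real_nat_ceiling_ge) simp
    finally have "f m \<le> nat \<lceil>c\<rceil> * m" by (metis of_nat_le_iff of_nat_mult)
    thus ?thesis by (simp add: K_def add_mult_distrib)
  next
    case False
    hence "f m \<le> (\<Sum>k<N. f k)" by (intro member_le_sum) auto
    also have "\<dots> \<le> K * 1" by (simp add: K_def)
    also have "\<dots> \<le> K * m" using that by (intro mult_le_mono) auto
    finally show ?thesis .
  qed
  thus ?thesis using that by blast
qed

text \<open>The time consists of the Gram matrix, its inversion, the initial weights and
  \<open>n - s\<close> iterations. The initial matrix is nonsingular by the rank assumption or by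
  regularization.\<close>

lemma regvol_correct:
  assumes X: "X \<in> carrier_mat n d" and lam: "0 \<le> lam"
    and rank: "lam = 0 \<Longrightarrow> vec_space.rank n X = d \<and> d \<le> s"
    and cost: "\<And>m. 1 \<le> m \<Longrightarrow> draw_cost m \<le> K * m"
  shows "lossless_spmf (regvol draw_cost X s lam) \<and>
    map_spmf fst (regvol draw_cost X s lam) = vol_sampling X s lam \<and>
    (\<forall>(S, t) \<in> set_spmf (regvol draw_cost X s lam). t \<le>
       d * d * (2 * n + 1) + (d * (d * d * 3) + n * (d * (2 * d) + (2 * d + 1))) +
       (n - s) * (K * n + (d * (2 * d) + (1 + (d * 1 + (n * (2 * d + 2) + d * d * 2))))))"
proof -
  let ?G = "reg_gram X lam {0..<n}"
  have "det ?G \<noteq> 0"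
    using det_reg_gram_nonzero[OF X subset_refl, of lam] det_gram_nonzero[OF X] lam rank
    by (cases "lam = 0") auto
  then obtain Z where Z: "runs (inverse_prog ?G) Z (d * (d * d * 3))" "Z \<in> carrier_mat d d" "?G * Z = 1\<^sub>m d"
    using runs_inverse_prog[OF reg_gram_carrier[OF X]] reg_gram_positive_definite[OF X subset_refl lam]
    by blast
  define h where "h = vec n (\<lambda>i. 1 - row X i \<bullet> (Z *\<^sub>v row X i))"
  have "runs (bind_prog (mat_vec_prog Z (row X i)) (\<lambda>u. bind_prog (dot_prog (row X i) u) (sub_op 1)))
      (1 - row X i \<bullet> (Z *\<^sub>v row X i)) (d * (2 * d) + (2 * d + 1))" for i
  proof -
    have "runs (bind_prog (dot_prog (row X i) (Z *\<^sub>v row X i)) (sub_op 1))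
        (1 - row X i \<bullet> (Z *\<^sub>v row X i)) (2 * d + 1)"
      using Z(2) by (intro leads_to_bind[OF runs_dot_prog runs_arith(2)[of 1]]) auto
    thus ?thesis
      using Z(2) X by (intro leads_to_bind[OF runs_mat_vec_prog]) auto
  qed
  hence h_run: "runs (vec_prog (dim_row X) (\<lambda>i. bind_prog (mat_vec_prog Z (row X i))
      (\<lambda>u. bind_prog (dot_prog (row X i) u) (sub_op 1)))) h (n * (d * (2 * d) + (2 * d + 1)))"
    unfolding carrier_matD(1)[OF X] h_def by (intro runs_vec_prog)
  have "leads_to (regvol draw_cost X s lam) (regvol_loop draw_cost X s Z h {0..<n})
      (d * d * (2 * n + 1) + (d * (d * d * 3) + n * (d * (2 * d) + (2 * d + 1))))"
    unfolding regvol_def carrier_matD(1)[OF X]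
    by (rule leads_to_bind[OF runs_reg_gram_prog[OF X]] leads_to_bind[OF Z(1)]
          leads_to_bind[OF h_run[unfolded carrier_matD(1)[OF X]] leads_to_refl[of _ 0]] order_refl)+ simp
  note start = leads_toD[OF this]
  have "h \<in> carrier_vec n" "\<And>j. j \<in> {0..<n} \<Longrightarrow> h $ j = 1 - row X j \<bullet> (Z *\<^sub>v row X j)"
    by (auto simp: h_def)
  from regvol_loop_correct[OF X lam _ cost subset_refl Z(2,3) this refl, of s] rank start
  show ?thesis
    using X by (auto simp: vol_sampling_def)
qed

text \<open>\<open>C\<close> precedes all sizes and inputs and depends on \<open>draw_cost\<close>
  alone. The time bound asks for \<open>1 \<le> d\<close> because its right-hand side vanishes at
  \<open>d = 0\<close>, where iterations still cost time.\<close>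

theorem theorem5p2:
  fixes draw_cost :: "nat \<Rightarrow> nat"
  assumes "(\<lambda>m. real (draw_cost m)) \<in> O(\<lambda>m. real m)"
  shows "\<exists>C::nat. \<forall>(n::nat) (d::nat) (X::real mat) (lam::real) (s::nat).
    X \<in> carrier_mat n d \<longrightarrow> d \<le> n \<longrightarrow> 0 \<le> lam \<longrightarrow> s \<le> n \<longrightarrow>
    (lam = 0 \<longrightarrow> vec_space.rank n X = d \<and> d \<le> s) \<longrightarrow>
      lossless_spmf (regvol draw_cost X s lam) \<and>
      map_spmf fst (regvol draw_cost X s lam) = vol_sampling X s lam \<and>
      (1 \<le> d \<longrightarrow> (\<forall>(S, t) \<in> set_spmf (regvol draw_cost X s lam). t \<le> C * ((n - s + d) * n * d)))"
proof -
  obtain K where K: "\<And>m. 1 \<le> m \<Longrightarrow> draw_cost m \<le> K * m"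
    using linear_bound_nat[OF assms] by blast
  \<comment> \<open>\<open>m\<close> stands for \<open>n - s\<close>. The setup costs at most
    \<open>11 * (n * (d * d))\<close> with 11 = 4 + 1 + 3 + 2 + 1, an iteration at most
    \<open>(K + 10) * (n * d)\<close> with 10 = 4 + 2 + 2 + 1 + 1; the factor \<open>K + 11\<close>
    covers both.\<close>
  have bound: "d * d * (2 * n + 1) + (d * (d * d * 3) + n * (d * (2 * d) + (2 * d + 1))) +
       m * (K * n + (d * (2 * d) + (1 + (d * 1 + (n * (2 * d + 2) + d * d * 2)))))
       \<le> (K + 11) * ((m + d) * n * d)" if d: "1 \<le> d" "d \<le> n" for n d m :: nat
  proof -
    have n: "1 \<le> n" using d by simp
    have le: "d * d \<le> n * d" "1 \<le> n * d" "d \<le> n * d" "n \<le> n * d"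
      using d n by (auto intro: mult_le_mono)
    have "d * d \<le> n * (d * d)" "d * (d * d) \<le> n * (d * d)" "n * d \<le> n * (d * d)" "n \<le> n * (d * d)"
      using d n le by (auto intro: mult_le_mono)
    moreover have "d * d * (2 * n + 1) + (d * (d * d * 3) + n * (d * (2 * d) + (2 * d + 1))) =
        4 * (n * (d * d)) + d * d + 3 * (d * (d * d)) + 2 * (n * d) + n"
      by (simp add: algebra_simps)
    ultimately have "d * d * (2 * n + 1) + (d * (d * d * 3) + n * (d * (2 * d) + (2 * d + 1))) \<le> 11 * (n * (d * d))"
      by linarith
    moreover have "K * n + (d * (2 * d) + (1 + (d * 1 + (n * (2 * d + 2) + d * d * 2)))) =
        K * n + 4 * (d * d) + 2 * (n * d) + 2 * n + d + 1" "(K + 10) * (n * d) = K * (n * d) + 10 * (n * d)"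
      by (simp_all add: algebra_simps)
    hence "K * n + (d * (2 * d) + (1 + (d * 1 + (n * (2 * d + 2) + d * d * 2)))) \<le> (K + 10) * (n * d)"
      using le mult_le_mono2[OF le(4), of K] by linarith
    hence "m * (K * n + (d * (2 * d) + (1 + (d * 1 + (n * (2 * d + 2) + d * d * 2)))))
        \<le> m * ((K + 10) * (n * d))"
      by (rule mult_le_mono2)
    ultimately show ?thesis by (simp add: algebra_simps)
  qed
  show ?thesis
  proof (intro exI[of _ "K + 11"] allI impI)
    fix n d s :: nat and X :: "real mat" and lam :: real
    assume X: "X \<in> carrier_mat n d" and d: "d \<le> n" and lam: "0 \<le> lam"
      and rank: "lam = 0 \<longrightarrow> vec_space.rank n X = d \<and> d \<le> s"
    note correct = regvol_correct[OF X lam _ K, of s, OF rank[rule_format]]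
    have "t \<le> (K + 11) * ((n - s + d) * n * d)"
      if "1 \<le> d" "(S, t) \<in> set_spmf (regvol draw_cost X s lam)" for S t
      using correct that(2) order_trans[OF _ bound[OF that(1) d, of "n - s"]] by blast
    thus "lossless_spmf (regvol draw_cost X s lam) \<and>
      map_spmf fst (regvol draw_cost X s lam) = vol_sampling X s lam \<and>
      (1 \<le> d \<longrightarrow> (\<forall>(S, t) \<in> set_spmf (regvol draw_cost X s lam).
        t \<le> (K + 11) * ((n - s + d) * n * d)))"
      using correct by blast
  qed
qed

end
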